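(* Let $\mathcal{F}$ be a filter on $\omega$, viewed as a subspace of $2^\omega$. Then $\mathcal{F}^2=\mathcal{F}\times\mathcal{F}$ (with the product topology) is homeomorphic to $\mathcal{F}$.
   Context: For $X,Y\subseteq\omega$, write $X\subseteq^\ast Y$ to mean that $X\setminus Y$ is finite, and $X=^\ast Y$ to mean that $X\subseteq^\ast Y$ and $Y\subseteq^\ast X$. A filter on $\omega$ is a collection $\mathcal{F}$ of subsets of $\omega$ such that: (1) $\varnothing\notin\mathcal{F}$ and $\omega\in\mathcal{F}$; (2) if $X\in\mathcal{F}$ and $X=^\ast Y\subseteq\omega$ then $Y\in\mathcal{F}$; (3) if $X\in\mathcal{F}$ and $X\subseteq Y\subseteq\omega$ then $Y\in\mathcal{F}$; (4) if $X,Y\in\mathcal{F}$ then $X\cap Y\in\mathcal{F}$. Any collection of subsets of $\omega$ is identified with the set of characteristic functions of its elements, and carries the subspace topology inherited from $2^\omega$ (product topology, with $2=\{0,1\}$ discrete). *)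

theory Defs
  imports "HOL-Analysis.Abstract_Topology" "HOL-Analysis.Product_Topology" "HOL-Analysis.Function_Topology"
begin

definition almost_subset :: "nat set \<Rightarrow> nat set \<Rightarrow> bool"  (infix "\<subseteq>\<^sup>*" 50)
  where "X \<subseteq>\<^sup>* Y \<longleftrightarrow> finite (X - Y)"

definition almost_eq :: "nat set \<Rightarrow> nat set \<Rightarrow> bool"  (infix "=\<^sup>*" 50)
  where "X =\<^sup>* Y \<longleftrightarrow> X \<subseteq>\<^sup>* Y \<and> Y \<subseteq>\<^sup>* X"

text \<open>
  Filters are proper and closed under finite modifications, so they contain all cofinite sets.
  The library type \<open>nat filter\<close> imposes neither condition.
\<close>

definition filter_on_omega :: "nat set set \<Rightarrow> bool"
  where "filter_on_omega F \<longleftrightarrow>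
    {} \<notin> F \<and> UNIV \<in> F \<and>
    (\<forall>X Y. X \<in> F \<and> X =\<^sup>* Y \<longrightarrow> Y \<in> F) \<and>
    (\<forall>X Y. X \<in> F \<and> X \<subseteq> Y \<longrightarrow> Y \<in> F) \<and>
    (\<forall>X Y. X \<in> F \<and> Y \<in> F \<longrightarrow> X \<inter> Y \<in> F)"

text \<open>The two-point set \<open>2 = {0, 1}\<close> is represented by the type \<^typ>\<open>bool\<close>.\<close>

definition cantor_space :: "(nat \<Rightarrow> bool) topology"
  where "cantor_space = product_topology (\<lambda>_. discrete_topology UNIV) UNIV"

definition char_fun :: "nat set \<Rightarrow> nat \<Rightarrow> bool"
  where "char_fun X = (\<lambda>n. n \<in> X)"

definition family_space :: "nat set set \<Rightarrow> (nat \<Rightarrow> bool) topology"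
  where "family_space F = subtopology cantor_space (char_fun ` F)"

end

theory Submission
  imports Defs "HOL-Analysis.T1_Spaces" "HOL-Library.Nat_Bijection" "HOL-Library.Infinite_Set"
begin

text \<open>
  It suffices to find a continuous bijection \<open>f : 2\<^sup>\<omega> \<times> 2\<^sup>\<omega> \<rightarrow> 2\<^sup>\<omega>\<close> with \<open>f (x, y) \<in> F\<close> if and only if
  \<open>x, y \<in> F\<close>: by compactness it is a homeomorphism, and it restricts to \<open>F \<times> F \<rightarrow> F\<close>.

  If \<open>F\<close> consists of the cofinite sets, interleaving is such a map. Otherwise some \<open>N \<in> F\<close> has
  infinite complement, and membership in \<open>F\<close> depends only on the trace on \<open>N\<close>, so the coordinates
  outside \<open>N\<close> are free storage. Put \<open>f (x, y) = x \<inter> y\<close> on \<open>N\<close>. At a point of \<open>N\<close> outside \<open>x \<inter> y\<close>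
  three cases remain to be recorded, which is done by a complete prefix code with three words, in an
  infinite block of free coordinates reserved for that point; the old contents of the block are
  shifted to make room.
\<close>

section \<open>Topology of Cantor space and reduction to a map on it\<close>

lemma topspace_cantor_space [simp]: "topspace cantor_space = UNIV"
  by (simp add: cantor_space_def)

lemma compact_space_cantor_space: "compact_space cantor_space"
  by (simp add: cantor_space_def compact_space_product_topology compact_space_discrete_topology)

lemma Hausdorff_space_cantor_space: "Hausdorff_space cantor_space"
  by (simp add: cantor_space_def Hausdorff_space_product_topology)

lemma continuous_map_into_cantor_space:
  "continuous_map X cantor_space f \<longleftrightarrow>
     (\<forall>n. continuous_map X (discrete_topology UNIV) (\<lambda>x. f x n))"
  by (simp add: cantor_space_def continuous_map_componentwise_UNIV)

text \<open>Discreteness of \<open>bool\<close> makes both the truth set of \<open>b\<close> and its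
  complement open, so every preimage is a union of two open pieces, one for each branch.\<close>

lemma continuous_map_If_discrete:
  fixes f g :: "'a \<Rightarrow> 'b"
  assumes "continuous_map X (discrete_topology UNIV) b"
    and "continuous_map X (discrete_topology UNIV) f"
    and "continuous_map X (discrete_topology UNIV) g"
  shows "continuous_map X (discrete_topology UNIV) (\<lambda>x. if b x then f x else g x)"
proof -
  have *: "openin X {x \<in> topspace X. h x \<in> U}"
    if "continuous_map X (discrete_topology UNIV) h" for h :: "'a \<Rightarrow> 'b" and U
    using that by (simp add: continuous_map_def)
  have b: "openin X {x \<in> topspace X. b x}" "openin X {x \<in> topspace X. \<not> b x}"
    using assms(1) by (auto simp: continuous_map_def dest: spec[of _ "{True}"] spec[of _ "{False}"])
  have "openin X {x \<in> topspace X. (if b x then f x else g x) \<in> U}" for U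
  proof -
    have "{x \<in> topspace X. (if b x then f x else g x) \<in> U} =
        {x \<in> topspace X. b x} \<inter> {x \<in> topspace X. f x \<in> U} \<union>
        {x \<in> topspace X. \<not> b x} \<inter> {x \<in> topspace X. g x \<in> U}"
      by auto
    then show ?thesis
      using * assms(2,3) b by (simp add: openin_Int openin_Un)
  qed
  then show ?thesis
    by (simp add: continuous_map_def)
qed

text \<open>Both directions of \<open>mem\<close> matter: one sends the square of the family into
  the family, the other makes the restricted bijection onto.\<close>

lemma family_square_homeomorphicI:
  assumes cont: "continuous_map (prod_topology cantor_space cantor_space) cantor_space f"
    and bij: "bij f"
    and mem: "\<And>x y. Collect (f (x, y)) \<in> F \<longleftrightarrow> Collect x \<in> F \<and> Collect y \<in> F"
  shows "prod_topology (family_space F) (family_space F) homeomorphic_space family_space F"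
proof -
  have char_fun: "x \<in> char_fun ` F \<longleftrightarrow> Collect x \<in> F" for x
    by (force simp: char_fun_def image_iff)
  have "homeomorphic_map (prod_topology cantor_space cantor_space) cantor_space f"
    using cont bij
    by (intro continuous_imp_homeomorphic_map)
      (auto simp: compact_space_prod_topology compact_space_cantor_space
        Hausdorff_space_cantor_space bij_def)
  then have "homeomorphic_map
      (subtopology (prod_topology cantor_space cantor_space) (char_fun ` F \<times> char_fun ` F))
      (subtopology cantor_space (char_fun ` F)) f"
    by (rule homeomorphic_map_subtopologies_alt) (simp add: mem_Times_iff char_fun split_paired_all mem)
  then show ?thesis
    by (simp add: family_space_def subtopology_Times homeomorphic_map_imp_homeomorphic_space)
qed

section \<open>Interleaving and the prefix code on a single row\<close>

definition interleave :: "(nat \<Rightarrow> 'a) \<Rightarrow> (nat \<Rightarrow> 'a) \<Rightarrow> nat \<Rightarrow> 'a"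
  where "interleave x y n = (if even n then x (n div 2) else y (n div 2))"

lemma interleave_even_odd: "interleave (\<lambda>n. z (2 * n)) (\<lambda>n. z (Suc (2 * n))) = z"
  by (auto simp: interleave_def fun_eq_iff)

lemma interleave_eq_iff: "interleave x y = interleave x' y' \<longleftrightarrow> x = x' \<and> y = y'"
proof
  assume eq: "interleave x y = interleave x' y'"
  show "x = x' \<and> y = y'"
  proof (intro conjI ext)
    fix n
    show "x n = x' n" "y n = y' n"
      using fun_cong[OF eq, of "2 * n"] fun_cong[OF eq, of "Suc (2 * n)"]
      by (simp_all add: interleave_def)
  qed
qed simp

text \<open>The heads (1,1), (0,0), (0,1), (1,0) become the words 1, 00, 010, 011, followed by the
  interleaved tails. No word is a prefix of another, which gives injectivity, and every sequence
  starts with one of them, which gives surjectivity. The first letter is the conjunction of the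
  heads.\<close>

definition row_merge :: "(nat \<Rightarrow> bool) \<Rightarrow> (nat \<Rightarrow> bool) \<Rightarrow> nat \<Rightarrow> bool"
  where "row_merge u v =
    (let w = interleave (u \<circ> Suc) (v \<circ> Suc)
     in case_nat (u 0 \<and> v 0)
          (if u 0 \<and> v 0 then w
           else if u 0 \<or> v 0 then case_nat True (case_nat (u 0) w)
           else case_nat False w))"

lemma row_merge_0 [simp]: "row_merge u v 0 \<longleftrightarrow> u 0 \<and> v 0"
  by (simp add: row_merge_def Let_def)

lemma case_nat_eq_iff: "case_nat a f = case_nat b g \<longleftrightarrow> a = b \<and> f = g"
proof
  assume eq: "case_nat a f = case_nat b g"
  show "a = b \<and> f = g"
  proof (intro conjI ext)
    show "a = b" using fun_cong[OF eq, of 0] by simp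
    show "f n = g n" for n using fun_cong[OF eq, of "Suc n"] by simp
  qed
qed simp

lemma case_nat_0_Suc: "case_nat (f 0) (f \<circ> Suc) = f"
  by (auto simp: fun_eq_iff split: nat.split)

lemma row_merge_inject:
  assumes "row_merge u v = row_merge u' v'"
  shows "u = u' \<and> v = v'"
proof -
  have "u 0 = u' 0 \<and> v 0 = v' 0 \<and> u \<circ> Suc = u' \<circ> Suc \<and> v \<circ> Suc = v' \<circ> Suc"
    using assms
    by (auto simp: row_merge_def Let_def case_nat_eq_iff interleave_eq_iff split: if_splits)
  then have "case_nat (u 0) (u \<circ> Suc) = case_nat (u' 0) (u' \<circ> Suc) \<and>
      case_nat (v 0) (v \<circ> Suc) = case_nat (v' 0) (v' \<circ> Suc)"
    by (simp only:)
  then show ?thesis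
    unfolding case_nat_0_Suc .
qed

lemma row_merge_surj: "\<exists>u v. row_merge u v = z"
proof -
  have *: "\<exists>u v. u 0 = a \<and> v 0 = b \<and> interleave (u \<circ> Suc) (v \<circ> Suc) = w" for a b :: bool and w
  proof (intro exI conjI)
    show "interleave (case_nat a (\<lambda>n. w (2 * n)) \<circ> Suc)
        (case_nat b (\<lambda>n. w (Suc (2 * n))) \<circ> Suc) = w"
      by (simp add: comp_def interleave_even_odd)
  qed simp_all
  define z1 where "z1 = z \<circ> Suc"
  define z2 where "z2 = z1 \<circ> Suc"
  define z3 where "z3 = z2 \<circ> Suc"
  have z: "z = case_nat (z 0) z1" and z1: "z1 = case_nat (z1 0) z2"
    and z2: "z2 = case_nat (z2 0) z3"
    unfolding z1_def z2_def z3_def by (rule case_nat_0_Suc[symmetric])+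
  \<comment> \<open>The leading code word of \<open>z\<close> is 1, 00 or 01b; in the last case the
    bit b, which is \<open>z2 0\<close>, is the head of \<open>u\<close> and its negation the head
    of \<open>v\<close>.\<close>
  consider "z 0" | "\<not> z 0" "\<not> z1 0" | "\<not> z 0" "z1 0" by blast
  then show ?thesis
  proof cases
    case 1
    obtain u v where "u 0 = True" "v 0 = True" "interleave (u \<circ> Suc) (v \<circ> Suc) = z1"
      using *[of True True z1] by (elim exE conjE)
    then have "row_merge u v = case_nat True z1"
      by (simp add: row_merge_def)
    then have "row_merge u v = z"
      by (subst z) (simp add: 1)
    then show ?thesis by blast
  next
    case 2
    obtain u v where "u 0 = False" "v 0 = False" "interleave (u \<circ> Suc) (v \<circ> Suc) = z2"
      using *[of False False z2] by (elim exE conjE)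
    then have "row_merge u v = case_nat False (case_nat False z2)"
      by (simp add: row_merge_def)
    then have "row_merge u v = z"
      by (subst z, subst z1) (simp add: 2)
    then show ?thesis by blast
  next
    case 3
    obtain u v where "u 0 = z2 0" "v 0 = (\<not> z2 0)" "interleave (u \<circ> Suc) (v \<circ> Suc) = z3"
      using *[of "z2 0" "\<not> z2 0" z3] by (elim exE conjE)
    then have "row_merge u v = case_nat False (case_nat True (case_nat (z2 0) z3))"
      by (simp add: row_merge_def)
    then have "row_merge u v = z"
      by (subst z, subst z1, subst z2) (simp add: 3)
    then show ?thesis by blast
  qed
qed

section \<open>Continuity of interleaving and of the code\<close>

lemma continuous_map_cantor_space_component:
  assumes "continuous_map X cantor_space f"
  shows "continuous_map X (discrete_topology UNIV) (\<lambda>x. f x n)"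
  using assms by (simp add: continuous_map_into_cantor_space)

lemma continuous_map_interleave:
  assumes "continuous_map X cantor_space f" "continuous_map X cantor_space g"
  shows "continuous_map X cantor_space (\<lambda>x. interleave (f x) (g x))"
  using assms by (simp add: continuous_map_into_cantor_space interleave_def)

lemma continuous_map_case_nat:
  assumes "continuous_map X (discrete_topology UNIV) a" "continuous_map X cantor_space f"
  shows "continuous_map X cantor_space (\<lambda>x. case_nat (a x) (f x))"
  unfolding continuous_map_into_cantor_space
proof
  show "continuous_map X (discrete_topology UNIV) (\<lambda>x. case_nat (a x) (f x) n)" for n
    using assms by (cases n) (simp_all add: continuous_map_into_cantor_space)
qed

lemma continuous_map_If_cantor_space:
  assumes "continuous_map X (discrete_topology UNIV) b"
    and "continuous_map X cantor_space f" "continuous_map X cantor_space g"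
  shows "continuous_map X cantor_space (\<lambda>x. if b x then f x else g x)"
  unfolding continuous_map_into_cantor_space if_distribR
  using assms(1) assms(2,3)[THEN continuous_map_cantor_space_component]
  by (intro allI continuous_map_If_discrete)

lemma continuous_map_row_merge:
  assumes f: "continuous_map X cantor_space f" and g: "continuous_map X cantor_space g"
  shows "continuous_map X cantor_space (\<lambda>x. row_merge (f x) (g x))"
proof -
  note component = continuous_map_cantor_space_component
  have tails: "continuous_map X cantor_space (\<lambda>x. f x \<circ> Suc)"
    "continuous_map X cantor_space (\<lambda>x. g x \<circ> Suc)"
    using f g by (simp_all add: continuous_map_into_cantor_space)
  \<comment> \<open>Conjunction and disjunction are written as conditionals so that
    \<open>continuous_map_If_discrete\<close> covers them.\<close>
  have "continuous_map X (discrete_topology UNIV) (\<lambda>x. if f x 0 then g x 0 else False)"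
    "continuous_map X (discrete_topology UNIV) (\<lambda>x. if f x 0 then True else g x 0)"
    by (intro continuous_map_If_discrete component[OF f] component[OF g]; simp)+
  moreover have "(\<lambda>x. if f x 0 then g x 0 else False) = (\<lambda>x. f x 0 \<and> g x 0)"
    "(\<lambda>x. if f x 0 then True else g x 0) = (\<lambda>x. f x 0 \<or> g x 0)"
    by auto
  ultimately have conj: "continuous_map X (discrete_topology UNIV) (\<lambda>x. f x 0 \<and> g x 0)"
    and disj: "continuous_map X (discrete_topology UNIV) (\<lambda>x. f x 0 \<or> g x 0)"
    by metis+
  show ?thesis
    unfolding row_merge_def Let_def
    by (intro continuous_map_case_nat continuous_map_If_cantor_space conj disj
        continuous_map_interleave tails component[OF f]) auto
qed

section \<open>The cofinite filter and the remaining filters\<close>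

lemma cofinite_square_homeomorphic:
  assumes "\<And>X. X \<in> F \<longleftrightarrow> finite (- X)"
  shows "prod_topology (family_space F) (family_space F) homeomorphic_space family_space F"
proof (rule family_square_homeomorphicI)
  let ?f = "\<lambda>(x, y). interleave x y"
  show "continuous_map (prod_topology cantor_space cantor_space) cantor_space ?f"
    unfolding case_prod_unfold
    by (intro continuous_map_interleave continuous_map_fst continuous_map_snd)
  show "bij ?f"
    by (rule bijI) (auto simp: inj_def interleave_eq_iff surj_def intro: interleave_even_odd[symmetric])
  fix x y :: "nat \<Rightarrow> bool"
  \<comment> \<open>Both maps on the right are injective, so the complement of the interleaving is
    finite exactly when both complements are.\<close>
  have "- Collect (interleave x y) = (*) 2 ` (- Collect x) \<union> (\<lambda>n. Suc (2 * n)) ` (- Collect y)"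
    by (force simp: interleave_def elim!: evenE oddE split: if_splits)
  moreover have "inj_on ((*) 2) A" "inj_on (\<lambda>n. Suc (2 * n)) A" for A :: "nat set"
    by (auto simp: inj_on_def)
  ultimately show "Collect (?f (x, y)) \<in> F \<longleftrightarrow> Collect x \<in> F \<and> Collect y \<in> F"
    by (simp add: assms finite_image_iff)
qed

text \<open>Arranges the coordinates in rows, each holding one point of \<open>N\<close> at its head
  and an infinite block of free coordinates behind it.\<close>

lemma ex_pairing_with_first_column:
  fixes N :: "nat set"
  assumes "infinite N" "infinite (- N)"
  shows "\<exists>p :: nat \<times> nat \<Rightarrow> nat. bij p \<and> (\<forall>k j. p (k, j) \<in> N \<longleftrightarrow> j = 0)"
proof -
  have enum: "bij_betw (enumerate N) UNIV N" "bij_betw (enumerate (- N)) UNIV (- N)"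
    using assms by (simp_all add: bij_enumerate)
  \<comment> \<open>Enumerating the complement along \<open>prod_encode\<close> cuts it into
    infinitely many infinite blocks, one for each \<open>k\<close>.\<close>
  define p where "p = (\<lambda>(k, j). case j of 0 \<Rightarrow> enumerate N k
      | Suc i \<Rightarrow> enumerate (- N) (prod_encode (k, i)))"
  have mem: "p (k, j) \<in> N \<longleftrightarrow> j = 0" for k j
    using enum by (auto simp: p_def bij_betw_def split: nat.split)
  moreover have "inj p"
  proof (rule injI, clarify)
    fix k j k' j'
    assume eq: "p (k, j) = p (k', j')"
    then have "j = 0 \<longleftrightarrow> j' = 0"
      using mem by metis
    then show "k = k' \<and> j = j'"
      using eq enum
      by (auto simp: p_def bij_betw_def inj_eq inj_prod_encode split: nat.splits)
  qed
  moreover have "n \<in> range p" for n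
  proof (cases "n \<in> N")
    case True
    then obtain k where "n = enumerate N k"
      using enum(1) by (metis bij_betw_imp_surj_on imageE)
    then have "n = p (k, 0)" by (simp add: p_def)
    then show ?thesis by blast
  next
    case False
    then obtain m where "n = enumerate (- N) m"
      using enum(2) by (metis bij_betw_imp_surj_on imageE ComplI)
    then have "n = p (fst (prod_decode m), Suc (snd (prod_decode m)))" by (simp add: p_def)
    then show ?thesis by blast
  qed
  ultimately show ?thesis
    by (intro exI[of _ p]) (auto simp: bij_def)
qed

lemma non_cofinite_square_homeomorphic:
  assumes F: "filter_on_omega F" and N: "N \<in> F" "infinite (- N)"
  shows "prod_topology (family_space F) (family_space F) homeomorphic_space family_space F"
proof -
  have up: "Y \<in> F" if "X \<in> F" "X \<subseteq> Y" for X Y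
    using F that unfolding filter_on_omega_def by blast
  have int: "X \<inter> Y \<in> F" if "X \<in> F" "Y \<in> F" for X Y
    using F that unfolding filter_on_omega_def by blast
  \<comment> \<open>A finite \<open>N\<close> would be almost equal to the empty set and so put that
    set into \<open>F\<close>.\<close>
  have "infinite N"
    using F N(1) unfolding filter_on_omega_def almost_eq_def almost_subset_def
    by (metis Diff_empty empty_Diff finite.emptyI)
  then obtain p :: "nat \<times> nat \<Rightarrow> nat" where p: "bij p" and pN: "\<And>k j. p (k, j) \<in> N \<longleftrightarrow> j = 0"
    using N(2) ex_pairing_with_first_column[of N] by auto
  define q where "q = inv p"
  have qp: "q (p i) = i" and pq: "p (q n) = n" for i n
    using p by (simp_all add: q_def bij_is_inj bij_is_surj surj_f_inv_f)
  define row where "row x k = (\<lambda>j. x (p (k, j)))" for x :: "nat \<Rightarrow> bool" and k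
  \<comment> \<open>The map acts on each row separately, so its bijectivity reduces to that of
    \<open>row_merge\<close>.\<close>
  define f where "f = (\<lambda>(x, y) n. row_merge (row x (fst (q n))) (row y (fst (q n))) (snd (q n)))"
  have row_f: "row (f (x, y)) k = row_merge (row x k) (row y k)" for x y k
    by (simp add: f_def row_def qp)
  have row_eq: "x = y" if "\<And>k. row x k = row y k" for x y
  proof
    fix n
    show "x n = y n"
      using fun_cong[OF that[of "fst (q n)"], of "snd (q n)"] by (simp add: row_def pq)
  qed
  show ?thesis
  proof (rule family_square_homeomorphicI)
    show "continuous_map (prod_topology cantor_space cantor_space) cantor_space f"
    proof -
      have row: "continuous_map X cantor_space (\<lambda>x. row (g x) k)"
        if "continuous_map X cantor_space g" for X and g :: "'c \<Rightarrow> nat \<Rightarrow> bool" and k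
        using that by (simp add: continuous_map_into_cantor_space row_def)
      show ?thesis
        unfolding f_def case_prod_unfold continuous_map_into_cantor_space
        by (intro allI continuous_map_cantor_space_component continuous_map_row_merge row
            continuous_map_fst continuous_map_snd)
    qed
    show "bij f"
    proof (rule bijI)
      show "inj f"
      proof (rule injI, clarify)
        fix x y x' y'
        assume "f (x, y) = f (x', y')"
        then have "row x k = row x' k \<and> row y k = row y' k" for k
          by (metis row_f row_merge_inject)
        then show "x = x' \<and> y = y'"
          using row_eq by metis
      qed
      show "surj f"
      proof -
        have "\<exists>a. z = f a" for z
        proof -
          \<comment> \<open>A preimage is chosen for all rows at once; \<open>q\<close> then
            reassembles the rows into two points.\<close>
          obtain u v where uv: "\<And>k. row_merge (u k) (v k) = row z k"
            using row_merge_surj[of "row z _"] by metis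
          have "row (\<lambda>n. u (fst (q n)) (snd (q n))) k = u k"
            "row (\<lambda>n. v (fst (q n)) (snd (q n))) k = v k" for k
            by (simp_all add: row_def qp)
          then have "z = f (\<lambda>n. u (fst (q n)) (snd (q n)), \<lambda>n. v (fst (q n)) (snd (q n)))"
            by - (rule row_eq, simp add: row_f uv)
          then show ?thesis by blast
        qed
        then show ?thesis by (simp add: surj_def)
      qed
    qed
    fix x y
    have "f (x, y) n \<longleftrightarrow> x n \<and> y n" if "n \<in> N" for n
    proof -
      have "q n = (fst (q n), 0)"
        using that pN[of "fst (q n)" "snd (q n)"] pq[of n] by (simp add: prod_eq_iff)
      then show ?thesis
        using pq[of n] by (metis (mono_tags) f_def case_prod_conv row_def row_merge_0 snd_conv)
    qed
    \<comment> \<open>As \<open>N\<close> lies in \<open>F\<close>, a set is in \<open>F\<close>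
      exactly when its trace on \<open>N\<close> is, so this equality decides membership whatever
      the code stores off \<open>N\<close>.\<close>
    then have eq: "Collect (f (x, y)) \<inter> N = Collect x \<inter> Collect y \<inter> N"
      by auto
    show "Collect (f (x, y)) \<in> F \<longleftrightarrow> Collect x \<in> F \<and> Collect y \<in> F"
    proof
      assume "Collect (f (x, y)) \<in> F"
      then have "Collect x \<inter> Collect y \<inter> N \<in> F"
        using int N(1) eq by metis
      then show "Collect x \<in> F \<and> Collect y \<in> F"
        by (auto elim: up)
    next
      assume "Collect x \<in> F \<and> Collect y \<in> F"
      then have "Collect (f (x, y)) \<inter> N \<in> F"
        using int N(1) eq by metis
      then show "Collect (f (x, y)) \<in> F"
        by (auto elim: up)
    qed
  qed
qed

theorem theorem6:
  fixes F :: "nat set set"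
  assumes "filter_on_omega F"
  shows "prod_topology (family_space F) (family_space F) homeomorphic_space family_space F"
proof (cases "\<exists>N\<in>F. infinite (- N)")
  case True
  then show ?thesis
    using assms non_cofinite_square_homeomorphic by blast
next
  case False
  \<comment> \<open>All members are cofinite in this case; closure under finite changes of
    \<open>UNIV\<close> gives the converse.\<close>
  have "X \<in> F" if "finite (- X)" for X
  proof -
    have "UNIV =\<^sup>* X"
      using that by (simp add: almost_eq_def almost_subset_def Compl_eq_Diff_UNIV)
    then show ?thesis
      using assms unfolding filter_on_omega_def by blast
  qed
  with False show ?thesis
    by (intro cofinite_square_homeomorphic) blast
qed

end
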